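(* Let $n\ge 2$ and let $a_1,a_2,\dotsc,a_n$ be non-negative real numbers. Let $2\le k\le n$ and set \[ \bar{a}=\frac{1}{k-1}(a_1+a_2+\dotsb+a_n). \] Let $a\ge 0$. Then the following are equivalent: (i) there exist Lebesgue measurable subsets $A_1,A_2,\dotsc,A_n$ of a Euclidean space, with Lebesgue measure $\mu$, such that $\mu(A_i)=a_i$ for all $i$, $\mu(A_1\cup\dotsb\cup A_n)=a$, and the intersection of any $k$ of the sets $A_1,\dotsc,A_n$ (with distinct indices) is empty; (ii) $\max\{a_1,a_2,\dotsc,a_n,\bar{a}\}\le a\le a_1+a_2+\dotsb+a_n$. Moreover, if $a_1,\dotsc,a_n$ and $a$ are non-negative integers, then the same equivalence holds with (i) replaced by: there exist finite sets $A_1,\dotsc,A_n$ such that $|A_i|=a_i$ for all $i$, $|A_1\cup\dotsb\cup A_n|=a$, and the intersection of any $k$ of the sets $A_1,\dotsc,A_n$ (with distinct indices) is empty.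
   Context: $\mu$ denotes Lebesgue measure in the measure case and cardinality in the finite-set case. *)

theory Defs
  imports "HOL-Analysis.Analysis" "HOL-Library.Infinite_Typeclass"
begin

definition k_intersections_empty :: "nat \<Rightarrow> nat \<Rightarrow> (nat \<Rightarrow> 'a set) \<Rightarrow> bool" where
  "k_intersections_empty n k A \<longleftrightarrow>
     (\<forall>I. I \<subseteq> {1..n} \<and> card I = k \<longrightarrow> (\<Inter>i\<in>I. A i) = {})"

definition a_bar :: "nat \<Rightarrow> nat \<Rightarrow> (nat \<Rightarrow> real) \<Rightarrow> real" where
  "a_bar n k a = 1 / (real k - 1) * (\<Sum>i=1..n. a i)"

text \<open>Measures are compared in the extended non-negative reals, so that a set of infinite
  measure is not mistaken for a null set.\<close>

definition lebesgue_realizes ::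
  "nat \<Rightarrow> nat \<Rightarrow> (nat \<Rightarrow> real) \<Rightarrow> real \<Rightarrow> (nat \<Rightarrow> 'e::euclidean_space set) \<Rightarrow> bool" where
  "lebesgue_realizes n k a s A \<longleftrightarrow>
     (\<forall>i\<in>{1..n}. A i \<in> sets lebesgue \<and> emeasure lebesgue (A i) = ennreal (a i)) \<and>
     emeasure lebesgue (\<Union>i\<in>{1..n}. A i) = ennreal s \<and>
     k_intersections_empty n k A"

definition finite_realizes ::
  "nat \<Rightarrow> nat \<Rightarrow> (nat \<Rightarrow> real) \<Rightarrow> real \<Rightarrow> (nat \<Rightarrow> 'b set) \<Rightarrow> bool" where
  "finite_realizes n k a s A \<longleftrightarrow>
     (\<forall>i\<in>{1..n}. finite (A i) \<and> real (card (A i)) = a i) \<and>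
     real (card (\<Union>i\<in>{1..n}. A i)) = s \<and>
     k_intersections_empty n k A"

end

theory Submission
  imports Defs
begin

text \<open>
  Necessity: a point lies in at most \<open>k - 1\<close> of the sets, so integrating the sum of the indicator
  functions gives \<open>\<Sum>i. a i \<le> (k - 1) * s\<close>.

  Sufficiency is McNaughton's wrap-around rule. Cut \<open>[0, T)\<close> with \<open>T = \<Sum>i. a i\<close> into consecutive
  intervals of lengths \<open>a 1, \<dots>, a n\<close> and wind them around a circle of length \<open>s\<close>. An interval does
  not overlap itself since \<open>a i \<le> s\<close>, the circle is covered since \<open>s \<le> T\<close>, and no point is hit
  more than \<open>k - 1\<close> times since \<open>T \<le> (k - 1) * s\<close>. Lebesgue measure and counting measure are
  treated together: all that is used of the measure space is a coordinate \<open>h\<close> with values in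
  \<open>[0, s)\<close> for which intervals (with endpoints in an additive group \<open>D\<close> of admissible numbers)
  have the right measure.
\<close>

section \<open>A common form of the two notions of realization\<close>

definition realizes ::
  "'x measure \<Rightarrow> nat \<Rightarrow> nat \<Rightarrow> (nat \<Rightarrow> real) \<Rightarrow> real \<Rightarrow> (nat \<Rightarrow> 'x set) \<Rightarrow> bool" where
  "realizes M n k a s A \<longleftrightarrow>
     (\<forall>i\<in>{1..n}. A i \<in> sets M \<and> emeasure M (A i) = ennreal (a i)) \<and>
     emeasure M (\<Union>i\<in>{1..n}. A i) = ennreal s \<and>
     k_intersections_empty n k A"

lemma lebesgue_realizes_iff: "lebesgue_realizes n k a s A \<longleftrightarrow> realizes lebesgue n k a s A"
  by (simp add: lebesgue_realizes_def realizes_def)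

text \<open>An infinite set has counting measure \<infinity>, which no \<open>ennreal r\<close>
  equals, so the equation on the left already forces finiteness.\<close>

lemma emeasure_count_space_eq_ennreal_iff:
  assumes "r \<ge> 0"
  shows "emeasure (count_space UNIV) S = ennreal r \<longleftrightarrow> finite S \<and> real (card S) = r"
  using assms
  by (cases "finite S") (auto simp: ennreal_of_nat_eq_real_of_nat)

lemma finite_realizes_iff:
  assumes "\<And>i. i \<in> {1..n} \<Longrightarrow> a i \<ge> 0" "s \<ge> 0"
  shows "finite_realizes n k a s A \<longleftrightarrow> realizes (count_space UNIV) n k a s A"
  using assms
  by (auto simp: finite_realizes_def realizes_def emeasure_count_space_eq_ennreal_iff)

section \<open>Necessity of the bounds\<close>

lemma realizes_imp_bounds:
  assumes a0: "\<And>i. i \<in> {1..n} \<Longrightarrow> a i \<ge> 0" and k: "2 \<le> k" and s0: "s \<ge> 0"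
    and R: "realizes M n k a s A"
  shows "Max (insert (a_bar n k a) (a ` {1..n})) \<le> s \<and> s \<le> (\<Sum>i=1..n. a i)"
proof -
  define U where "U = (\<Union>i\<in>{1..n}. A i)"
  have meas [measurable]: "A i \<in> sets M" and em: "emeasure M (A i) = ennreal (a i)"
    if "i \<in> {1..n}" for i
    using R that by (auto simp: realizes_def)
  have U [measurable]: "U \<in> sets M" unfolding U_def using meas by blast
  have emU: "emeasure M U = ennreal s" and ke: "k_intersections_empty n k A"
    using R by (auto simp: realizes_def U_def)
  have le: "a i \<le> s" if i: "i \<in> {1..n}" for i
  proof -
    have "emeasure M (A i) \<le> emeasure M U"
      by (rule emeasure_mono) (use i U in \<open>auto simp: U_def\<close>)
    then show ?thesis using em[OF i] emU s0 by simp
  qed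
  have sum_em: "(\<Sum>i=1..n. emeasure M (A i)) = ennreal (\<Sum>i=1..n. a i)"
    using em a0 by (subst sum_ennreal[symmetric]) auto
  have "emeasure M U \<le> (\<Sum>i=1..n. emeasure M (A i))"
    unfolding U_def by (rule emeasure_subadditive_finite) (use meas in auto)
  then have upper: "s \<le> (\<Sum>i=1..n. a i)"
    using sum_em emU by (metis a0 ennreal_le_iff sum_nonneg)
  \<comment> \<open>The left side counts the indices in \<open>J\<close>. If it reached
    \<open>k\<close>, then \<open>x\<close> would lie in an intersection of \<open>k\<close> of the
    sets. The factor \<open>indicator U x\<close> makes the bound integrate to \<open>k - 1\<close>
    times the measure of \<open>U\<close>.\<close>
  have pt: "(\<Sum>i=1..n. indicator (A i) x) \<le> of_nat (k - 1) * (indicator U x :: ennreal)" for x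
  proof -
    define J where "J = {1..n} \<inter> {i. x \<in> A i}"
    have J: "(\<Sum>i=1..n. indicator (A i) x) = (of_nat (card J) :: ennreal)"
      by (simp add: J_def indicator_def)
    have "card J < k"
    proof (rule ccontr)
      assume "\<not> card J < k"
      then obtain I where I: "I \<subseteq> J" "card I = k"
        by (meson not_less obtain_subset_with_card_n)
      then have "(\<Inter>i\<in>I. A i) = {}"
        using ke by (auto simp: k_intersections_empty_def J_def)
      moreover have "x \<in> (\<Inter>i\<in>I. A i)" using I by (auto simp: J_def)
      ultimately show False by blast
    qed
    then have *: "(of_nat (card J) :: ennreal) \<le> of_nat (k - 1)"
      by (intro of_nat_mono) simp
    show ?thesis
    proof (cases "x \<in> U")
      case True
      then show ?thesis using * J by simp
    next
      case False
      then have "J = {}" by (auto simp: J_def U_def)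
      then show ?thesis using J by simp
    qed
  qed
  have "(\<Sum>i=1..n. emeasure M (A i)) = (\<integral>\<^sup>+x. (\<Sum>i=1..n. indicator (A i) x) \<partial>M)"
    by (subst nn_integral_sum) (auto simp: meas)
  also have "\<dots> \<le> (\<integral>\<^sup>+x. of_nat (k - 1) * indicator U x \<partial>M)"
    by (intro nn_integral_mono pt)
  also have "\<dots> = of_nat (k - 1) * emeasure M U"
    by (simp add: nn_integral_cmult_indicator)
  also have "\<dots> = ennreal (real (k - 1) * s)"
    using s0 emU by (simp add: ennreal_mult ennreal_of_nat_eq_real_of_nat)
  finally have "(\<Sum>i=1..n. a i) \<le> (real k - 1) * s"
    using sum_em s0 k by (simp add: of_nat_diff)
  then have "a_bar n k a \<le> s"
    using k by (simp add: a_bar_def field_simps)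
  then show ?thesis using le upper by auto
qed

section \<open>Sufficiency: the wrap-around construction\<close>

text \<open>An interval \<open>[p, p + c)\<close> with \<open>p = u + q * s\<close>, wound around the circle, becomes at most two
  intervals: one starting at \<open>u\<close> and one starting at \<open>0\<close>.\<close>
lemma wrap_interval_iff:
  fixes s t u c :: real and q :: nat
  assumes s: "s > 0" and t: "0 \<le> t" "t < s" and u: "0 \<le> u" "u < s" and c: "0 \<le> c" "c \<le> s"
  shows "(\<exists>m::nat. u + real q * s \<le> t + real m * s \<and> t + real m * s < u + real q * s + c) \<longleftrightarrow>
         u \<le> t \<and> t < min (u + c) s \<or> 0 \<le> t \<and> t < max 0 (u + c - s)"
proof
  assume "\<exists>m::nat. u + real q * s \<le> t + real m * s \<and> t + real m * s < u + real q * s + c"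
  then obtain m :: nat
    where m: "u + real q * s \<le> t + real m * s" "t + real m * s < u + real q * s + c" by blast
  \<comment> \<open>Only the laps \<open>q\<close> and \<open>q + 1\<close> can meet the interval:
    as \<open>t < s\<close>, a point of an earlier lap lies before its start; as
    \<open>u < s\<close> and \<open>c \<le> s\<close>, it ends before lap \<open>q + 2\<close>
    begins.\<close>
  have "\<not> m < q"
  proof
    assume "m < q"
    then have "(real m + 1) * s \<le> real q * s" using s by (intro mult_right_mono) auto
    then show False using m t u by (simp add: algebra_simps)
  qed
  moreover have "\<not> m \<ge> q + 2"
  proof
    assume "m \<ge> q + 2"
    then have "(real q + 2) * s \<le> real m * s" using s by (intro mult_right_mono) auto
    then show False using m t u c by (simp add: algebra_simps)
  qed
  ultimately consider "m = q" | "m = q + 1" by linarith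
  then show "u \<le> t \<and> t < min (u + c) s \<or> 0 \<le> t \<and> t < max 0 (u + c - s)"
    by cases (use m t in \<open>auto simp: algebra_simps\<close>)
next
  assume "u \<le> t \<and> t < min (u + c) s \<or> 0 \<le> t \<and> t < max 0 (u + c - s)"
  then show "\<exists>m::nat. u + real q * s \<le> t + real m * s \<and> t + real m * s < u + real q * s + c"
  proof
    assume "u \<le> t \<and> t < min (u + c) s"
    then show ?thesis by (intro exI[of _ q]) auto
  next
    assume "0 \<le> t \<and> t < max 0 (u + c - s)"
    then have "t < u + c - s" using t by auto
    then show ?thesis using t u by (intro exI[of _ "q + 1"]) (auto simp: algebra_simps)
  qed
qed

text \<open>\<open>X\<close> is the circle cut open and \<open>h\<close> the position on it. Closure
  of \<open>D\<close> under sums and differences keeps every endpoint that the winding produces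
  admissible for \<open>meas\<close>.\<close>

lemma bounds_imp_realizes:
  fixes h :: "'x \<Rightarrow> real" and D :: "real set"
  assumes a0: "\<And>i. i \<in> {1..n} \<Longrightarrow> a i \<ge> 0" and k: "2 \<le> k" and s0: "s \<ge> 0"
    and bounds: "Max (insert (a_bar n k a) (a ` {1..n})) \<le> s" "s \<le> (\<Sum>i=1..n. a i)"
    and h: "\<And>x. x \<in> X \<Longrightarrow> 0 \<le> h x \<and> h x < s"
    and D: "0 \<in> D" "\<And>x y. x \<in> D \<Longrightarrow> y \<in> D \<Longrightarrow> x + y \<in> D" "\<And>x y. x \<in> D \<Longrightarrow> y \<in> D \<Longrightarrow> x - y \<in> D"
    and aD: "\<And>i. i \<in> {1..n} \<Longrightarrow> a i \<in> D" and sD: "s \<in> D"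
    and meas: "\<And>u v. u \<in> D \<Longrightarrow> v \<in> D \<Longrightarrow> 0 \<le> u \<Longrightarrow> u \<le> v \<Longrightarrow> v \<le> s \<Longrightarrow>
        {x\<in>X. u \<le> h x \<and> h x < v} \<in> sets M \<and>
        emeasure M {x\<in>X. u \<le> h x \<and> h x < v} = ennreal (v - u)"
  shows "\<exists>A. realizes M n k a s A"
proof -
  have le: "a i \<le> s" if "i \<in> {1..n}" for i using bounds(1) that by auto
  have "a_bar n k a \<le> s" using bounds(1) by auto
  then have T: "(\<Sum>i=1..n. a i) \<le> (real k - 1) * s"
    using k by (simp add: a_bar_def field_simps)
  show ?thesis
  proof (cases "s = 0")
    case True
    then have "a i = 0" if "i \<in> {1..n}" for i using le a0 that by fastforce
    \<comment> \<open>All sets are taken empty. An intersection over no indices would be the whole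
      type, hence the need for \<open>k > 0\<close>.\<close>
    moreover have "I \<noteq> {}" if "card I = k" for I :: "nat set" using that k by auto
    ultimately have "realizes M n k a s (\<lambda>_. {})"
      using True by (auto simp: realizes_def k_intersections_empty_def)
    then show ?thesis by blast
  next
    case False
    with s0 have s: "s > 0" by simp
    define S where "S j = (\<Sum>i=1..j. a i)" for j
    have S0: "S 0 = 0" by (simp add: S_def)
    have SSuc: "S (Suc j) = S j + a (Suc j)" for j by (simp add: S_def)
    have S_mono: "S i \<le> S j" if "i \<le> j" "j \<le> n" for i j
      unfolding S_def by (rule sum_mono2) (use that a0 in auto)
    have S_nonneg: "0 \<le> S j" if "j \<le> n" for j
      using S_mono[of 0 j] that S0 by simp
    have SD: "S j \<in> D" if "j \<le> n" for j
      using that by (induction j) (auto simp: S0 SSuc D aD)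
    have mult_D: "real q * s \<in> D" for q :: nat
      by (induction q) (auto simp: D sD algebra_simps)
    \<comment> \<open>\<open>m\<close> counts completed laps: \<open>x\<close> belongs to
      \<open>A i\<close> when some lap carries its position into the \<open>i\<close>-th
      interval.\<close>
    define A where
      "A i = {x\<in>X. \<exists>m::nat. S (i - 1) \<le> h x + real m * s \<and> h x + real m * s < S i}" for i
    have A: "A i \<in> sets M \<and> emeasure M (A i) = ennreal (a i)" if i: "i \<in> {1..n}" for i
    proof -
      have Si: "S i = S (i - 1) + a i" using SSuc[of "i - 1"] i by simp
      \<comment> \<open>\<open>q\<close> is the number of full laps completed before the interval
        starts, and \<open>u\<close> is the position on the circle where it starts.\<close>
      define q where "q = nat \<lfloor>S (i - 1) / s\<rfloor>"
      define u where "u = S (i - 1) - real q * s"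
      have Spos: "S (i - 1) \<ge> 0" using S_nonneg[of "i - 1"] i by auto
      have q: "real q = of_int \<lfloor>S (i - 1) / s\<rfloor>" using Spos s by (simp add: q_def)
      have "real q \<le> S (i - 1) / s" "S (i - 1) / s < real q + 1"
        unfolding q by linarith+
      then have u: "0 \<le> u" "u < s" using s by (auto simp: u_def field_simps)
      have ai: "0 \<le> a i" "a i \<le> s" using a0 le i by auto
      have uD: "u \<in> D" unfolding u_def using D(3) SD mult_D i by auto
      have vD: "u + a i \<in> D" using D(2) uD aD i by auto
      \<comment> \<open>\<open>?B\<close> is the piece inside lap \<open>q\<close>,
        \<open>?C\<close> the overhang into the next lap; \<open>max 0\<close> makes
        \<open>?C\<close> empty if there is no overhang.\<close>
      let ?B = "{x\<in>X. u \<le> h x \<and> h x < min (u + a i) s}"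
      let ?C = "{x\<in>X. 0 \<le> h x \<and> h x < max 0 (u + a i - s)}"
      have Aeq: "A i = ?B \<union> ?C"
      proof -
        have "S (i - 1) = u + real q * s" "S i = u + real q * s + a i"
          using Si by (auto simp: u_def)
        then have "x \<in> A i \<longleftrightarrow> x \<in> ?B \<union> ?C" if "x \<in> X" for x
          using wrap_interval_iff[OF s _ _ u ai, of "h x" q] h[OF that] that by (simp add: A_def)
        moreover have "A i \<subseteq> X" by (auto simp: A_def)
        ultimately show ?thesis by blast
      qed
      have B: "?B \<in> sets M \<and> emeasure M ?B = ennreal (min (u + a i) s - u)"
        by (rule meas) (use uD vD sD u ai in \<open>auto simp: min_def\<close>)
      have C: "?C \<in> sets M \<and> emeasure M ?C = ennreal (max 0 (u + a i - s) - 0)"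
        by (rule meas) (use D vD sD u ai in \<open>auto simp: max_def\<close>)
      \<comment> \<open>The overhang stops at \<open>u + a i - s \<le> u\<close>, so the interval
        does not run over its own start.\<close>
      have "?B \<inter> ?C = {}" using ai by auto
      then have "emeasure M (A i) = emeasure M ?B + emeasure M ?C"
        unfolding Aeq using B C by (intro plus_emeasure[symmetric]) auto
      also have "\<dots> = ennreal ((min (u + a i) s - u) + (max 0 (u + a i - s) - 0))"
        using B C u ai by (subst ennreal_plus) auto
      also have "\<dots> = ennreal (a i)" by (rule arg_cong[of _ _ ennreal]) auto
      finally show ?thesis using B C unfolding Aeq by auto
    qed
    have "(\<Union>i\<in>{1..n}. A i) = {x\<in>X. 0 \<le> h x \<and> h x < s}"
    proof (intro equalityI subsetI)
      fix x assume "x \<in> (\<Union>i\<in>{1..n}. A i)"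
      then show "x \<in> {x\<in>X. 0 \<le> h x \<and> h x < s}" using h by (auto simp: A_def)
    next
      fix x assume "x \<in> {x\<in>X. 0 \<le> h x \<and> h x < s}"
      then have x: "x \<in> X" "0 \<le> h x" "h x < s" by auto
      \<comment> \<open>Lap 0 alone covers the circle because \<open>s \<le> S n\<close>; the first
        partial sum beyond \<open>h x\<close> marks the interval that contains it.\<close>
      define i where "i = (LEAST i. h x < S i)"
      have n: "h x < S n" using x bounds(2) by (simp add: S_def)
      have i: "h x < S i" unfolding i_def using n by (rule LeastI)
      have "i \<le> n" unfolding i_def using n by (rule Least_le)
      moreover have "i \<noteq> 0" using i x S0 by (cases i) auto
      moreover have "\<not> h x < S (i - 1)"
        using not_less_Least[of "i - 1" "\<lambda>i. h x < S i"] \<open>i \<noteq> 0\<close> by (simp add: i_def)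
      ultimately have "i \<in> {1..n}" "x \<in> A i"
        using i x by (auto simp: A_def intro!: exI[of _ 0])
      then show "x \<in> (\<Union>i\<in>{1..n}. A i)" by blast
    qed
    then have U: "emeasure M (\<Union>i\<in>{1..n}. A i) = ennreal s"
      using meas[of 0 s] D sD s0 by simp
    have "(\<Inter>i\<in>I. A i) = {}" if I: "I \<subseteq> {1..n}" "card I = k" for I
    proof (rule ccontr)
      assume "(\<Inter>i\<in>I. A i) \<noteq> {}"
      then obtain x where x: "\<And>i. i \<in> I \<Longrightarrow> x \<in> A i" by blast
      then have "\<forall>i\<in>I. \<exists>m::nat. S (i - 1) \<le> h x + real m * s \<and> h x + real m * s < S i"
        by (auto simp: A_def)
      then obtain m :: "nat \<Rightarrow> nat" where
        m: "\<And>i. i \<in> I \<Longrightarrow> S (i - 1) \<le> h x + real (m i) * s \<and> h x + real (m i) * s < S i"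
        by metis
      \<comment> \<open>On the same lap, one number would lie in two disjoint intervals. Hence
        distinct indices use distinct laps.\<close>
      have False if "i \<in> I" "j \<in> I" "m i = m j" "i < j" for i j
        using m[of i] m[of j] S_mono[of i "j - 1"] that I by fastforce
      then have inj: "inj_on m I" by (metis inj_onI nat_neq_iff)
      \<comment> \<open>The whole length \<open>S n\<close> fits into \<open>k - 1\<close> laps,
        which leaves too few lap numbers for \<open>k\<close> indices.\<close>
      have "m i < k - 1" if i: "i \<in> I" for i
      proof -
        have "x \<in> X" using x[OF i] by (simp add: A_def)
        then have "0 \<le> h x" using h by blast
        then have "real (m i) * s < S i" using m[OF i] by linarith
        also have "S i \<le> S n" using S_mono i I by auto
        also have "\<dots> \<le> (real k - 1) * s" using T by (simp add: S_def)
        finally have "real (m i) < real k - 1" using s by simp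
        then show ?thesis by linarith
      qed
      then have "m ` I \<subseteq> {..<k - 1}" by blast
      then have "card I \<le> card {..<k - 1}"
        using inj by (metis card_image card_mono finite_lessThan)
      then show False using I k by simp
    qed
    then have "realizes M n k a s A"
      using A U by (auto simp: realizes_def k_intersections_empty_def)
    then show ?thesis by blast
  qed
qed

section \<open>Lebesgue measure and counting measure as instances\<close>

text \<open>Up to a null hyperplane, \<open>H\<close> is a box with side \<open>v - u\<close> along
  \<open>b\<close> and unit sides otherwise. It is half-open along \<open>b\<close> to match the
  intervals on the circle.\<close>

lemma emeasure_lebesgue_slab:
  fixes b :: "'e::euclidean_space"
  assumes b: "b \<in> Basis" and uv: "0 \<le> u" "u \<le> v"
  defines "H \<equiv> {x. (\<forall>c\<in>Basis - {b}. 0 \<le> x \<bullet> c \<and> x \<bullet> c \<le> 1) \<and> u \<le> x \<bullet> b \<and> x \<bullet> b < v}"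
  shows "H \<in> sets lebesgue" and "emeasure lebesgue H = ennreal (v - u)"
proof -
  define l r where "l = u *\<^sub>R b" and "r = (\<Sum>c\<in>Basis. (if c = b then v else 1) *\<^sub>R c)"
  have l: "l \<bullet> c = (if c = b then u else 0)" if "c \<in> Basis" for c
    using that b by (auto simp: l_def inner_Basis)
  have r: "r \<bullet> c = (if c = b then v else 1)" if "c \<in> Basis" for c
    using that by (simp add: r_def)
  have H: "H = cbox l r - {x. x \<bullet> b = v}"
  proof (rule set_eqI)
    fix x
    have "x \<in> cbox l r \<longleftrightarrow> (\<forall>c\<in>Basis. (if c = b then u else 0) \<le> x \<bullet> c \<and> x \<bullet> c \<le> (if c = b then v else 1))"
      unfolding mem_box using l r by auto
    also have "\<dots> \<longleftrightarrow> (\<forall>c\<in>Basis - {b}. 0 \<le> x \<bullet> c \<and> x \<bullet> c \<le> 1) \<and> u \<le> x \<bullet> b \<and> x \<bullet> b \<le> v"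
      using b by auto
    finally show "x \<in> H \<longleftrightarrow> x \<in> cbox l r - {x. x \<bullet> b = v}"
      by (auto simp: H_def)
  qed
  have null: "{x. x \<bullet> b = v} \<in> null_sets lebesgue"
    using negligible_standard_hyperplane[OF b] negligible_iff_null_sets by blast
  then show "H \<in> sets lebesgue" unfolding H by auto
  have "emeasure lebesgue H = emeasure lebesgue (cbox l r)"
    unfolding H using null by (intro emeasure_Diff_null_set) auto
  also have "\<dots> = ennreal (\<Prod>c\<in>Basis. (r - l) \<bullet> c)"
    using uv l r by (subst emeasure_completion) (auto simp: emeasure_lborel_cbox)
  also have "(\<Prod>c\<in>Basis. (r - l) \<bullet> c) = (\<Prod>c\<in>Basis. if c = b then v - u else 1)"
    using l r by (intro prod.cong) (auto simp: inner_diff_left)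
  also have "\<dots> = v - u" using b by simp
  finally show "emeasure lebesgue H = ennreal (v - u)" .
qed

text \<open>The circle is a slab of length \<open>s\<close> along one axis with unit cross-section,
  so that volume equals length along that axis.\<close>

lemma bounds_imp_lebesgue_realizes:
  assumes "\<And>i. i \<in> {1..n} \<Longrightarrow> a i \<ge> 0" and "2 \<le> k" and "s \<ge> 0"
    and "Max (insert (a_bar n k a) (a ` {1..n})) \<le> s" "s \<le> (\<Sum>i=1..n. a i)"
  shows "\<exists>A :: nat \<Rightarrow> 'e::euclidean_space set. realizes lebesgue n k a s A"
proof -
  obtain b :: 'e where b: "b \<in> Basis" using nonempty_Basis by blast
  define X where "X = {x::'e. (\<forall>c\<in>Basis - {b}. 0 \<le> x \<bullet> c \<and> x \<bullet> c \<le> 1) \<and> 0 \<le> x \<bullet> b \<and> x \<bullet> b < s}"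
  have eq: "{x\<in>X. u \<le> x \<bullet> b \<and> x \<bullet> b < v} =
      {x. (\<forall>c\<in>Basis - {b}. 0 \<le> x \<bullet> c \<and> x \<bullet> c \<le> 1) \<and> u \<le> x \<bullet> b \<and> x \<bullet> b < v}"
    if "0 \<le> u" "v \<le> s" for u v
    using that by (auto simp: X_def)
  show ?thesis
  proof (rule bounds_imp_realizes[OF assms, where X = X and h = "\<lambda>x. x \<bullet> b" and D = UNIV])
    fix u v :: real
    assume "0 \<le> u" "u \<le> v" "v \<le> s"
    then show "{x\<in>X. u \<le> x \<bullet> b \<and> x \<bullet> b < v} \<in> sets lebesgue \<and>
        emeasure lebesgue {x\<in>X. u \<le> x \<bullet> b \<and> x \<bullet> b < v} = ennreal (v - u)"
      using eq emeasure_lebesgue_slab[OF b] by simp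
  qed (auto simp: X_def)
qed

text \<open>The circle is the image of the naturals below \<open>s\<close> under an injection
  \<open>f\<close>, and \<open>h\<close> reads the index back. The choice is
  \<open>D = \<int>\<close> because \<open>\<nat>\<close> is not closed under differences.\<close>

lemma bounds_imp_count_space_realizes:
  assumes "\<And>i. i \<in> {1..n} \<Longrightarrow> a i \<ge> 0" and "2 \<le> k" and "s \<ge> 0"
    and "Max (insert (a_bar n k a) (a ` {1..n})) \<le> s" "s \<le> (\<Sum>i=1..n. a i)"
    and aN: "\<And>i. i \<in> {1..n} \<Longrightarrow> a i \<in> \<nat>" and sN: "s \<in> \<nat>"
  shows "\<exists>A :: nat \<Rightarrow> 'b::infinite set. realizes (count_space UNIV) n k a s A"
proof -
  obtain f :: "nat \<Rightarrow> 'b" where f: "inj f"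
    using infinite_UNIV infinite_countable_subset by blast
  have Nats_Ints: "x \<in> \<int>" if "x \<in> \<nat>" for x :: real
    using that Nats_subset_Ints by blast
  define h where "h = (\<lambda>x. real (inv f x))"
  define X where "X = f ` {j. real j < s}"
  show ?thesis
  proof (rule bounds_imp_realizes[OF assms(1-5), where X = X and h = h and D = \<int>])
    fix u v :: real
    assume uv: "u \<in> \<int>" "v \<in> \<int>" "0 \<le> u" "u \<le> v" "v \<le> s"
    \<comment> \<open>Non-negative integer endpoints are naturals \<open>p\<close> and
      \<open>q\<close>, and the half-open interval then contains exactly \<open>q - p\<close>
      indices.\<close>
    then have "u = real (nat \<lfloor>u\<rfloor>)" "v = real (nat \<lfloor>v\<rfloor>)"
      by (auto elim!: Ints_cases)
    then obtain p q :: nat where pq: "u = real p" "v = real q"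
      by blast
    have "{x\<in>X. u \<le> h x \<and> h x < v} = f ` {p..<q}"
      using uv f by (auto simp: X_def h_def pq)
    moreover have "card (f ` {p..<q}) = q - p"
      using f by (simp add: card_image inj_on_subset)
    ultimately show "{x\<in>X. u \<le> h x \<and> h x < v} \<in> sets (count_space UNIV) \<and>
        emeasure (count_space UNIV) {x\<in>X. u \<le> h x \<and> h x < v} = ennreal (v - u)"
      using uv pq by (simp add: ennreal_of_nat_eq_real_of_nat of_nat_diff)
  qed (use f aN sN Nats_Ints in \<open>auto simp: X_def h_def\<close>)
qed

theorem mainTheorem1:
  fixes n k :: nat and a :: "nat \<Rightarrow> real" and s :: real
  assumes "n \<ge> 2"
    and "\<And>i. i \<in> {1..n} \<Longrightarrow> a i \<ge> 0"
    and "2 \<le> k" and "k \<le> n"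
    and "s \<ge> 0"
  shows "((\<exists>A :: nat \<Rightarrow> 'e::euclidean_space set. lebesgue_realizes n k a s A) \<longleftrightarrow>
            Max (insert (a_bar n k a) (a ` {1..n})) \<le> s \<and> s \<le> (\<Sum>i=1..n. a i)) \<and>
         ((\<forall>i\<in>{1..n}. a i \<in> \<nat>) \<and> s \<in> \<nat> \<longrightarrow>
           ((\<exists>A :: nat \<Rightarrow> 'b::infinite set. finite_realizes n k a s A) \<longleftrightarrow>
              Max (insert (a_bar n k a) (a ` {1..n})) \<le> s \<and> s \<le> (\<Sum>i=1..n. a i)))"
proof (intro conjI impI)
  show "(\<exists>A :: nat \<Rightarrow> 'e set. lebesgue_realizes n k a s A) \<longleftrightarrow>
      Max (insert (a_bar n k a) (a ` {1..n})) \<le> s \<and> s \<le> (\<Sum>i=1..n. a i)"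
    unfolding lebesgue_realizes_iff
    using realizes_imp_bounds[of n a k s] bounds_imp_lebesgue_realizes[of n a k s] assms(2,3,5)
    by blast
next
  assume N: "(\<forall>i\<in>{1..n}. a i \<in> \<nat>) \<and> s \<in> \<nat>"
  have "finite_realizes n k a s A \<longleftrightarrow> realizes (count_space UNIV) n k a s A" for A :: "nat \<Rightarrow> 'b set"
    using finite_realizes_iff assms(2,5) by blast
  then show "(\<exists>A :: nat \<Rightarrow> 'b set. finite_realizes n k a s A) \<longleftrightarrow>
      Max (insert (a_bar n k a) (a ` {1..n})) \<le> s \<and> s \<le> (\<Sum>i=1..n. a i)"
    using realizes_imp_bounds[of n a k s] bounds_imp_count_space_realizes[of n a k s] assms(2,3,5) N
    by blast
qed

end
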